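(* Let $1\le j\le n$ and let $I_{n,j}$ be the number of ancestors $i$ of the node $j$ with $i>j$ in a labelled ordered tree of size $n$ chosen uniformly at random. Then for $0\le k\le n-j$, $$\mathbb{P}\{I_{n,j}=k\}=\frac{1}{\binom{n-1}{j-1}\binom{2(n-1)}{n-1}}\sum_{\ell=n-j-k}^{n-k-1}\binom{\ell}{n-j-k}\binom{2n-2}{\ell}\binom{n-\ell-1}{k}\frac{2n-1-2\ell}{2n-1-\ell}.$$
   Context: A labelled ordered tree of size $n$ is a rooted tree with $n$ vertices, in which the children of each node are linearly ordered (left to right), and whose vertices are labelled bijectively with $1,\dots,n$ (all labellings allowed). Vertices are identified with their labels; $i$ is an ancestor of $j$ if $i\ne j$ lies on the path from the root to $j$. *)

theory Defs
  imports "HOL-Probability.Probability"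
begin

datatype 'a otree = Node 'a "'a otree list"

text \<open>The labels of all vertices in preorder, one entry per vertex.\<close>

fun labels :: "'a otree \<Rightarrow> 'a list" where
  "labels (Node a ts) = a # concat (map labels ts)"

definition labelled_otrees :: "nat \<Rightarrow> nat otree set" where
  "labelled_otrees n =
     {t. length (labels t) = n \<and> distinct (labels t) \<and> set (labels t) = {1..n}}"

text \<open>\<open>root_path t xs\<close>: the list \<open>xs\<close> consists of the labels along a path that starts at
  the root of \<open>t\<close> and descends to some vertex, both end points included.\<close>

inductive root_path :: "'a otree \<Rightarrow> 'a list \<Rightarrow> bool" where
  root: "root_path (Node a ts) [a]"
| child: "t \<in> set ts \<Longrightarrow> root_path t xs \<Longrightarrow> root_path (Node a ts) (a # xs)"

definition ancestor :: "'a otree \<Rightarrow> 'a \<Rightarrow> 'a \<Rightarrow> bool" where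
  "ancestor t i j \<longleftrightarrow> i \<noteq> j \<and> (\<exists>xs. root_path t xs \<and> last xs = j \<and> i \<in> set xs)"

definition larger_ancestors :: "nat otree \<Rightarrow> nat \<Rightarrow> nat" where
  "larger_ancestors t j = card {i. ancestor t i j \<and> i > j}"

text \<open>\<open>pmf_of_set\<close> is the uniform distribution only on finite nonempty sets.\<close>

lemma finite_labelled_otrees: "finite (labelled_otrees n)"
proof -
  have ne': "labels t \<noteq> []" for t :: "nat otree"
    by (cases t) simp
  have ne: "length (labels t) \<ge> 1" for t :: "nat otree"
    by (cases t) simp
  have len: "length ts \<le> length (concat (map labels ts))" for ts :: "nat otree list"
  proof (induction ts)
    case (Cons t ts)
    then show ?case using ne[of t] by simp
  qed simp
  have mem: "length (labels t) \<le> length (concat (map labels ts))"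
    if "t \<in> set ts" for t and ts :: "nat otree list"
    using that by (induction ts) auto
  have fin: "finite {t :: nat otree. length (labels t) \<le> m \<and> set (labels t) \<subseteq> {1..n}}" for m
  proof (induction m)
    case 0
    have "{t :: nat otree. length (labels t) \<le> 0 \<and> set (labels t) \<subseteq> {1..n}} = {}"
      using ne' by simp
    then show ?case by simp
  next
    case (Suc m)
    define A where "A = {t :: nat otree. length (labels t) \<le> m \<and> set (labels t) \<subseteq> {1..n}}"
    have "{t :: nat otree. length (labels t) \<le> Suc m \<and> set (labels t) \<subseteq> {1..n}}
            \<subseteq> (\<lambda>(a, ts). Node a ts) ` ({1..n} \<times> {ts. set ts \<subseteq> A \<and> length ts \<le> m})"
    proof
      fix t :: "nat otree"
      assume t: "t \<in> {t. length (labels t) \<le> Suc m \<and> set (labels t) \<subseteq> {1..n}}"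
      obtain a ts where [simp]: "t = Node a ts" by (cases t)
      have l: "length (concat (map labels ts)) \<le> m" using t by simp
      have "set ts \<subseteq> A"
      proof
        fix u
        assume u: "u \<in> set ts"
        have "length (labels u) \<le> m" using mem[OF u] l by linarith
        moreover have "set (labels u) \<subseteq> {1..n}" using t u by auto
        ultimately show "u \<in> A" by (simp add: A_def)
      qed
      moreover have "length ts \<le> m" using len[of ts] l by linarith
      ultimately have "(a, ts) \<in> {1..n} \<times> {ts. set ts \<subseteq> A \<and> length ts \<le> m}"
        using t by simp
      then show "t \<in> (\<lambda>(a, ts). Node a ts) ` ({1..n} \<times> {ts. set ts \<subseteq> A \<and> length ts \<le> m})"
        by force
    qed
    moreover have "finite A" using Suc.IH by (simp add: A_def)
    ultimately show ?case
      by (elim finite_subset) (intro finite_imageI finite_SigmaI finite_lists_length_le; simp)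
  qed
  show ?thesis
    by (rule finite_subset[OF _ fin[of n]]) (auto simp: labelled_otrees_def)
qed

lemma labelled_otrees_nonempty:
  assumes "n \<ge> 1"
  shows "labelled_otrees n \<noteq> {}"
proof -
  define t where "t = Node 1 (map (\<lambda>i. Node i []) [2..<Suc n])"
  have "concat (map labels (map (\<lambda>i :: nat. Node i []) xs)) = xs" for xs
    by (induction xs) auto
  then have "labels t = 1 # [2..<Suc n]"
    by (simp only: t_def labels.simps)
  then have "t \<in> labelled_otrees n"
    using assms by (auto simp: labelled_otrees_def)
  then show ?thesis by blast
qed

end

theory Submission
  imports Defs "HOL-Combinatorics.Multiset_Permutations"
begin

text \<open>A labelled tree contains exactly one path from the root to the node \<open>j\<close>; write it as
  \<open>xs @ [j]\<close> with \<open>d = length xs\<close>. The number of larger ancestors of \<open>j\<close> is the number of entries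
  of \<open>xs\<close> that exceed \<open>j\<close>, so the trees in question are classified by their path.

  For a fixed path the trees are easy to count. Removing the \<open>d + 1\<close> vertices of the path leaves the
  siblings to the left and to the right of the path below each of the \<open>d\<close> ancestors, and the
  children of \<open>j\<close>: altogether \<open>2 d + 1\<close> ordered forests on the other \<open>n - 1 - d\<close> labels
  (\<open>spine_configs_bij\<close>). The number \<open>g r m\<close> of \<open>r\<close>-tuples of forests on \<open>m\<close> labels satisfies
  \<open>g (r + 1) m = g r m + m * g (r + 2) (m - 1)\<close>: either the first forest is empty, or the root of
  its first tree can be deleted, which splits that forest into two. This ballot-like recursion has
  the solution \<open>g r m = r (2 m + r - 1)! / (m + r)!\<close> (\<open>finite_card_forest_tuples\<close>). In
  particular the number of trees depends on the path only through \<open>d\<close>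
  (\<open>card_trees_with_path\<close>), and the case \<open>d = 0\<close> gives the number of all labelled trees.

  It remains to choose the path: there are \<open>(n - j choose k) * (j - 1 choose e) * (k + e)!\<close> ordered
  lists with \<open>k\<close> entries above \<open>j\<close> and \<open>e\<close> entries below \<open>j\<close>. Summing over \<open>e\<close>, substituting
  \<open>l = n - 1 - d = n - 1 - k - e\<close>, and using the symmetry of the hypergeometric distribution
  (\<open>binomial_exchange\<close>) gives the formula.\<close>

section \<open>Counting tuples of labelled forests\<close>

abbreviation forest_labels :: "'a otree list \<Rightarrow> 'a list" where
  "forest_labels ts \<equiv> concat (map labels ts)"

definition forest_tuples :: "nat \<Rightarrow> 'a set \<Rightarrow> 'a otree list list set" where
  "forest_tuples r S = {fs. length fs = r \<and> distinct (forest_labels (concat fs)) \<and>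
     set (forest_labels (concat fs)) = S}"

text \<open>Grafting a new root \<open>a\<close> onto the first forest and placing the resulting tree at the front of
  the second forest inverts the deletion of the first root. The second equation is a dummy value.\<close>

fun graft :: "'a \<Rightarrow> 'a otree list list \<Rightarrow> 'a otree list list" where
  "graft a (ts # us # fs) = (Node a ts # us) # fs"
| "graft a fs = fs"

lemma labels_nonempty [simp]: "labels t \<noteq> []"
  by (cases t) simp

lemma forest_tuples_empty: "forest_tuples r {} = {replicate r []}"
proof -
  have "fs = replicate (length fs) []" if "set (forest_labels (concat fs)) = {}"
    for fs :: "'a otree list list"
  proof -
    have "\<forall>f\<in>set fs. f = []"
      using that by (auto simp: subset_iff)
    then show ?thesis by (simp add: replicate_length_same)
  qed
  then show ?thesis
    by (auto simp: forest_tuples_def)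
qed

lemma forest_tuples_0: "S \<noteq> {} \<Longrightarrow> forest_tuples 0 S = {}"
  by (auto simp: forest_tuples_def)

lemma graft_in_forest_tuples:
  assumes "a \<in> S" "fs \<in> forest_tuples (Suc (Suc r)) (S - {a})"
  shows "graft a fs \<in> forest_tuples (Suc r) S"
proof -
  obtain ts us gs where fs: "fs = ts # us # gs" "length gs = r"
    using assms(2) by (auto simp: forest_tuples_def length_Suc_conv)
  let ?l = "\<lambda>fs. forest_labels (concat fs)"
  have l: "?l (graft a fs) = a # ?l fs" using fs by simp
  have d: "distinct (?l fs)" "set (?l fs) = S - {a}"
    using assms(2) unfolding forest_tuples_def by blast+
  have "distinct (?l (graft a fs))" "set (?l (graft a fs)) = S"
    unfolding l list.set(2) distinct.simps d(2) using d(1) assms(1) by blast+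
  moreover have "length (graft a fs) = Suc r" using fs by simp
  ultimately show ?thesis unfolding forest_tuples_def by blast
qed

text \<open>The first forest of a tuple is empty, or its first tree has a root \<open>a\<close>; in the latter case
  the children of \<open>a\<close> and the remaining trees of that forest become two separate forests.\<close>

lemma forest_tuples_Suc:
  "forest_tuples (Suc r) S =
     (#) [] ` forest_tuples r S \<union> (\<Union>a\<in>S. graft a ` forest_tuples (Suc (Suc r)) (S - {a}))"
  (is "?L = ?E \<union> ?N")
proof (intro equalityI subsetI)
  fix gs assume gs: "gs \<in> ?L"
  then obtain f fs where [simp]: "gs = f # fs"
    by (auto simp: forest_tuples_def length_Suc_conv)
  show "gs \<in> ?E \<union> ?N"
  proof (cases f)
    case Nil
    then show ?thesis using gs by (auto simp: forest_tuples_def)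
  next
    case (Cons t us)
    obtain a ts where [simp]: "t = Node a ts" by (cases t)
    have "gs = graft a (ts # us # fs)" using Cons by simp
    moreover have "ts # us # fs \<in> forest_tuples (Suc (Suc r)) (S - {a})" and "a \<in> S"
      using gs Cons by (auto simp: forest_tuples_def)
    ultimately show ?thesis by blast
  qed
next
  fix gs assume "gs \<in> ?E \<union> ?N"
  then show "gs \<in> ?L"
  proof
    assume "gs \<in> ?E"
    then obtain fs where "gs = [] # fs" "fs \<in> forest_tuples r S" by blast
    then show ?thesis by (simp add: forest_tuples_def)
  next
    assume "gs \<in> ?N"
    then obtain a fs where "a \<in> S" "fs \<in> forest_tuples (Suc (Suc r)) (S - {a})" "gs = graft a fs"
      by (elim UN_E imageE)
    then show ?thesis using graft_in_forest_tuples by simp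
  qed
qed

lemma inj_on_graft: "inj_on (graft a) (forest_tuples (Suc (Suc r)) S)"
proof (rule inj_onI)
  fix f g assume fg: "f \<in> forest_tuples (Suc (Suc r)) S" "g \<in> forest_tuples (Suc (Suc r)) S"
    and eq: "graft a f = graft a g"
  obtain ts us f' where "f = ts # us # f'"
    using fg(1) unfolding forest_tuples_def by (auto simp only: length_Suc_conv mem_Collect_eq)
  moreover obtain ts us g' where "g = ts # us # g'"
    using fg(2) unfolding forest_tuples_def by (auto simp only: length_Suc_conv mem_Collect_eq)
  ultimately show "f = g" using eq by simp
qed

lemma card_forest_tuples_Suc:
  assumes fin: "finite S"
    and fin_r: "finite (forest_tuples r S)"
    and card_r: "\<And>a. a \<in> S \<Longrightarrow> finite (forest_tuples (Suc (Suc r)) (S - {a})) \<and>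
                   card (forest_tuples (Suc (Suc r)) (S - {a})) = c"
  shows "finite (forest_tuples (Suc r) S)"
    and "card (forest_tuples (Suc r) S) = card (forest_tuples r S) + card S * c"
proof -
  let ?E = "(#) [] ` forest_tuples r S"
  let ?N = "\<lambda>a. graft a ` forest_tuples (Suc (Suc r)) (S - {a})"
  have root: "hd (hd (graft a fs)) = Node a (hd fs) \<and> hd (graft a fs) \<noteq> []"
    if "fs \<in> forest_tuples (Suc (Suc r)) T" for a fs and T :: "'a set"
    using that by (auto simp: forest_tuples_def length_Suc_conv)
  have finN: "finite (?N a)" if "a \<in> S" for a
    using card_r[OF that] by blast
  show "finite (forest_tuples (Suc r) S)"
    unfolding forest_tuples_Suc[of r S] using fin fin_r finN by blast
  have disj: "?N a \<inter> ?N b = {}" if "a \<noteq> b" for a b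
  proof (rule ccontr)
    assume "?N a \<inter> ?N b \<noteq> {}"
    then obtain f g where fg: "f \<in> forest_tuples (Suc (Suc r)) (S - {a})"
        "g \<in> forest_tuples (Suc (Suc r)) (S - {b})" "graft a f = graft b g"
      by blast
    then have "Node a (hd f) = Node b (hd g)" using root[OF fg(1), of a] root[OF fg(2), of b] by simp
    then show False using that by simp
  qed
  have "card (\<Union>a\<in>S. ?N a) = (\<Sum>a\<in>S. card (?N a))"
    using fin finN disj by (intro card_UN_disjoint) auto
  also have "\<dots> = (\<Sum>a\<in>S. c)"
    using card_r by (intro sum.cong refl) (simp add: card_image inj_on_graft)
  finally have cN: "card (\<Union>a\<in>S. ?N a) = card S * c" by simp
  have "?E \<inter> (\<Union>a\<in>S. ?N a) = {}"
  proof (rule ccontr)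
    assume "?E \<inter> (\<Union>a\<in>S. ?N a) \<noteq> {}"
    then obtain x where x: "x \<in> ?E" "x \<in> (\<Union>a\<in>S. ?N a)" by blast
    then obtain g where "x = [] # g" by blast
    moreover obtain a f where "f \<in> forest_tuples (Suc (Suc r)) (S - {a})" "x = graft a f"
      using x(2) by blast
    ultimately obtain a f g where "f \<in> forest_tuples (Suc (Suc r)) (S - {a})" "graft a f = [] # g"
      by simp
    then show False using root[of f "S - {a}" a] by simp
  qed
  then have "card (?E \<union> (\<Union>a\<in>S. ?N a)) = card ?E + card (\<Union>a\<in>S. ?N a)"
    using fin fin_r finN by (intro card_Un_disjoint) auto
  then show "card (forest_tuples (Suc r) S) = card (forest_tuples r S) + card S * c"
    unfolding forest_tuples_Suc[of r S] cN by (simp add: card_image)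
qed

text \<open>The recursion lowers the number \<open>m\<close> of labels or keeps it and lowers the number \<open>r\<close> of forests,
  hence the nested induction. With the closed form, the step reduces to the identity
  \<open>r (m + r + 1) + m (r + 2) = (r + 1) (2 m + r)\<close>. The hypothesis excludes \<open>r = m = 0\<close>, where the
  count is 1 but the closed form vanishes.\<close>

lemma finite_card_forest_tuples:
  assumes "finite S" and "r > 0 \<or> S \<noteq> {}"
  shows "finite (forest_tuples r S) \<and>
    card (forest_tuples r S) * fact (card S + r) = r * fact (2 * card S + r - 1)"
  using assms
proof (induction "card S" arbitrary: S r)
  case 0
  then have "S = {}" "r > 0" by auto
  then show ?case by (simp add: forest_tuples_empty fact_reduce)
next
  case (Suc m)
  have S: "S \<noteq> {}" using Suc.hyps by auto
  show ?case
  proof (induction r)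
    case 0
    then show ?case using S by (simp add: forest_tuples_0)
  next
    case (Suc r)
    (* The common number of (r + 2)-tuples on the labels S - {a}; the quotient is exact. *)
    define c :: nat where "c = (r + 2) * fact (2 * m + r + 1) div fact (m + r + 2)"
    have IH: "finite (forest_tuples (Suc (Suc r)) (S - {a})) \<and>
       card (forest_tuples (Suc (Suc r)) (S - {a})) * fact (m + r + 2) = (r + 2) * fact (2 * m + r + 1)"
      if "a \<in> S" for a
    proof -
      have "card (S - {a}) = m" using \<open>Suc m = card S\<close>[symmetric] that by simp
      moreover have "m + Suc (Suc r) = m + r + 2" "2 * m + Suc (Suc r) - 1 = 2 * m + r + 1"
        "Suc (Suc r) = r + 2" by simp_all
      ultimately show ?thesis
        using Suc.hyps(1)[of "S - {a}" "Suc (Suc r)"] \<open>finite S\<close> by (metis finite_Diff zero_less_Suc)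
    qed
    have c: "finite (forest_tuples (Suc (Suc r)) (S - {a})) \<and>
       card (forest_tuples (Suc (Suc r)) (S - {a})) = c" if "a \<in> S" for a
      using IH[OF that] unfolding c_def
      by (metis fact_nonzero nonzero_mult_div_cancel_right)
    obtain a where "a \<in> S" using S by blast
    then have c_eq: "c * fact (m + r + 2) = (r + 2) * fact (2 * m + r + 1)"
      using IH[of a] c[of a] by simp
    let ?g = "card (forest_tuples r S)"
    have g: "?g * fact (m + r + 1) = r * fact (2 * m + r + 1)"
      using Suc.IH \<open>Suc m = card S\<close>[symmetric] by (simp add: ac_simps)
    have "(?g + Suc m * c) * fact (m + r + 2) =
        (m + r + 2) * (?g * fact (m + r + 1)) + Suc m * (c * fact (m + r + 2))"
      by (simp add: algebra_simps)
    also have "\<dots> = (r + 1) * ((2 * m + r + 2) * fact (2 * m + r + 1))"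
      unfolding g c_eq by (simp add: algebra_simps)
    also have "\<dots> = (r + 1) * fact (2 * m + r + 2)"
      by simp
    finally have "(?g + Suc m * c) * fact (m + r + 2) = (r + 1) * fact (2 * m + r + 2)" .
    moreover have "finite (forest_tuples r S)" using Suc.IH by blast
    note card_forest_tuples_Suc[OF \<open>finite S\<close> this c]
    ultimately show ?case
      using \<open>Suc m = card S\<close>[symmetric] by (simp add: numeral_eq_Suc)
  qed
qed

section \<open>Trees with a prescribed root path\<close>

lemma root_path_Cons_iff:
  "root_path t (a # xs) \<longleftrightarrow>
     (\<exists>ts. t = Node a ts \<and> (xs = [] \<or> (\<exists>c\<in>set ts. root_path c xs)))"
proof
  assume "root_path t (a # xs)"
  then show "\<exists>ts. t = Node a ts \<and> (xs = [] \<or> (\<exists>c\<in>set ts. root_path c xs))"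
    by cases auto
next
  assume "\<exists>ts. t = Node a ts \<and> (xs = [] \<or> (\<exists>c\<in>set ts. root_path c xs))"
  then show "root_path t (a # xs)"
    by (elim exE conjE disjE bexE) (simp_all add: root_path.root root_path.child)
qed

lemma root_path_nonempty: "root_path t xs \<Longrightarrow> xs \<noteq> []"
  by (induction rule: root_path.induct) auto

lemma root_path_subset: "root_path t xs \<Longrightarrow> set xs \<subseteq> set (labels t)"
  by (induction rule: root_path.induct) auto

lemma distinct_forest_member:
  "distinct (forest_labels ts) \<Longrightarrow> t \<in> set ts \<Longrightarrow> distinct (labels t)"
  by (auto dest!: split_list)

lemma root_path_distinct: "root_path t xs \<Longrightarrow> distinct (labels t) \<Longrightarrow> distinct xs"
proof (induction rule: root_path.induct)
  case (child t ts xs a)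
  then show ?case
    using root_path_subset[OF child(2)] by (auto intro: distinct_forest_member)
qed simp

lemma root_path_exists: "b \<in> set (labels t) \<Longrightarrow> \<exists>xs. root_path t (xs @ [b])"
proof (induction t)
  case (Node a ts)
  show ?case
  proof (cases "b = a")
    case True
    then show ?thesis by (intro exI[of _ "[]"]) (simp add: root_path.root)
  next
    case False
    then obtain c where c: "c \<in> set ts" "b \<in> set (labels c)" using Node.prems by auto
    then obtain xs where "root_path c (xs @ [b])" using Node.IH by blast
    then have "root_path (Node a ts) ((a # xs) @ [b])" using c by (auto intro: root_path.child)
    then show ?thesis by blast
  qed
qed

lemma distinct_forest_label_unique:
  assumes "distinct (forest_labels ts)" "t \<in> set ts" "u \<in> set ts"
    and "b \<in> set (labels t)" "b \<in> set (labels u)"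
  shows "t = u"
  using assms by (induction ts) auto

text \<open>Sibling subtrees have disjoint label sets, so the last label of a path determines at every
  vertex the child through which the path continues.\<close>

lemma root_path_unique:
  "root_path t xs \<Longrightarrow> root_path t ys \<Longrightarrow> last xs = last ys \<Longrightarrow> distinct (labels t) \<Longrightarrow> xs = ys"
proof (induction arbitrary: ys rule: root_path.induct)
  case (root a ts)
  show ?case
  proof (rule ccontr)
    assume ne: "[a] \<noteq> ys"
    from root(1) obtain ys' where ys: "ys = a # ys'"
      by cases auto
    with ne root obtain c where c: "c \<in> set ts" "root_path c ys'"
      by (auto simp: root_path_Cons_iff)
    have "last ys' \<in> set (labels c)"
      using root_path_subset[OF c(2)] root_path_nonempty[OF c(2)] by auto
    then show False using root ys c root_path_nonempty[OF c(2)] by auto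
  qed
next
  case (child t ts xs a)
  have xs: "xs \<noteq> []" "last xs \<in> set (labels t)"
    using root_path_subset[OF child.hyps(2)] root_path_nonempty[OF child.hyps(2)] by auto
  have dist: "distinct (forest_labels ts)" "a \<notin> set (forest_labels ts)"
    using child.prems(3) by simp_all
  have neq: "last xs \<noteq> a" using xs(2) child.hyps(1) dist(2) by auto
  obtain ys' where ys: "ys = a # ys'"
    using child.prems(1) by cases auto
  have ne: "ys' \<noteq> []" using ys child.prems(2) neq xs(1) by auto
  then obtain c where c: "c \<in> set ts" "root_path c ys'"
    using child.prems(1) ys by (auto simp: root_path_Cons_iff)
  have last: "last xs = last ys'" using child.prems(2) ys xs(1) ne by simp
  have "last xs \<in> set (labels c)"
    using root_path_subset[OF c(2)] ne last by auto
  then have "c = t"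
    using distinct_forest_label_unique[OF dist(1) c(1) child.hyps(1)] xs(2) by blast
  moreover have "distinct (labels t)"
    using distinct_forest_member[OF dist(1) child.hyps(1)] .
  ultimately show ?case using child.IH c(2) last ys by simp
qed

text \<open>The additional forests \<open>fs\<close> collect what has already been cut off from the upper part of a path,
  so that the number of trees with a given path can be found by induction on the path.\<close>

definition spine_configs :: "'a list \<Rightarrow> nat \<Rightarrow> 'a set \<Rightarrow> ('a otree \<times> 'a otree list list) set" where
  "spine_configs xs r S = {(t, fs). root_path t xs \<and> length fs = r \<and>
     distinct (labels t @ forest_labels (concat fs)) \<and>
     set (labels t @ forest_labels (concat fs)) = S}"

text \<open>Moves the root label between the label list of a tree and the set of labels that remain
  available below it.\<close>

lemma distinct_root_first:
  assumes "a \<in> S"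
  shows "distinct (a # us @ xs) \<and> set (a # us @ xs) = S \<longleftrightarrow>
    distinct (us @ xs) \<and> set (us @ xs) = S - {a}"
  using assms by auto

lemma spine_configs_root:
  assumes "a \<in> S"
  shows "bij_betw (\<lambda>fs. (Node a (hd fs), tl fs)) (forest_tuples (Suc r) (S - {a})) (spine_configs [a] r S)"
    (is "bij_betw ?h ?A ?B")
proof (rule bij_betw_byWitness[where f' = "\<lambda>(t, fs). (case t of Node b ts \<Rightarrow> ts # fs)"])
  have iff: "ts # fs \<in> ?A \<longleftrightarrow> (Node a ts, fs) \<in> ?B" for ts fs
    using distinct_root_first[OF assms, of "forest_labels ts" "forest_labels (concat fs)"]
    unfolding forest_tuples_def spine_configs_def mem_Collect_eq prod.case
    by (simp only: length_Cons nat.inject concat.simps map_append concat_append labels.simps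
        append_Cons root_path.root simp_thms)
  have A: "\<exists>ts gs. fs = ts # gs" if "fs \<in> ?A" for fs
    using that unfolding forest_tuples_def length_Suc_conv by blast
  have B: "\<exists>ts gs. p = (Node a ts, gs)" if "p \<in> ?B" for p
    using that unfolding spine_configs_def root_path_Cons_iff by blast
  show "\<forall>fs\<in>?A. (\<lambda>(t, fs). (case t of Node b ts \<Rightarrow> ts # fs)) (?h fs) = fs"
    using A by fastforce
  show "\<forall>p\<in>?B. ?h ((\<lambda>(t, fs). (case t of Node b ts \<Rightarrow> ts # fs)) p) = p"
    using B by fastforce
  show "?h ` ?A \<subseteq> ?B"
  proof (intro image_subsetI)
    fix fs assume "fs \<in> ?A"
    then show "?h fs \<in> ?B" using A[of fs] iff by (metis list.sel(1,3))
  qed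
  show "(\<lambda>(t, fs). (case t of Node b ts \<Rightarrow> ts # fs)) ` ?B \<subseteq> ?A"
  proof (intro image_subsetI)
    fix p assume p: "p \<in> ?B"
    then obtain ts gs where "p = (Node a ts, gs)" using B by blast
    then show "(\<lambda>(t, fs). (case t of Node b ts \<Rightarrow> ts # fs)) p \<in> ?A" using p iff by simp
  qed
qed

text \<open>Used with \<open>P\<close> saying that a subtree contains the next label of the path: the child on the path is
  the only such subtree, so the siblings to its left and right can be recovered.\<close>

lemma split_at_unique:
  assumes "us @ c # vs = us' @ c' # vs'"
    and "P c" "P c'" "\<forall>u\<in>set us. \<not> P u" "\<forall>u\<in>set us'. \<not> P u"
  shows "us = us' \<and> c = c' \<and> vs = vs'"
proof -
  have "takeWhile (\<lambda>u. \<not> P u) (us @ c # vs) = us"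
    "takeWhile (\<lambda>u. \<not> P u) (us' @ c' # vs') = us'"
    using assms(2-5) by (auto simp: takeWhile_append2)
  then have "us = us'" using assms(1) by metis
  then show ?thesis using assms(1) by simp
qed

text \<open>Cutting off the root \<open>a\<close> turns the siblings on either side of the next path vertex into two new
  forests.\<close>

lemma spine_configs_child:
  assumes "a \<in> S"
  shows "bij_betw (\<lambda>(c, fs). (Node a (hd fs @ c # hd (tl fs)), tl (tl fs)))
     (spine_configs (b # ys) (Suc (Suc r)) (S - {a})) (spine_configs (a # b # ys) r S)"
    (is "bij_betw ?h ?A ?B")
proof (rule bij_betwI')
  have iff: "(Node a (us @ c # vs), fs) \<in> ?B \<longleftrightarrow> (c, us # vs # fs) \<in> ?A"
    if "root_path c (b # ys)" for c us vs fs
  proof -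
    let ?new = "forest_labels us @ labels c @ forest_labels vs @ forest_labels (concat fs)"
    let ?old = "labels c @ forest_labels us @ forest_labels vs @ forest_labels (concat fs)"
    have "distinct ?new = distinct ?old" "set ?new = set ?old" by auto
    then have "distinct (a # ?new) \<and> set (a # ?new) = S \<longleftrightarrow> distinct ?old \<and> set ?old = S - {a}"
      using distinct_root_first[OF assms, of "forest_labels us"
          "labels c @ forest_labels vs @ forest_labels (concat fs)"] by simp
    moreover have "labels (Node a (us @ c # vs)) @ forest_labels (concat fs) = a # ?new"
      "labels c @ forest_labels (concat (us # vs # fs)) = ?old"
      "root_path (Node a (us @ c # vs)) (a # b # ys)"
      using that by (auto intro: root_path.child)
    ultimately show ?thesis
      unfolding spine_configs_def mem_Collect_eq prod.case using that by (simp only: length_Cons nat.inject simp_thms)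
  qed
  have A: "\<exists>c us vs fs. p = (c, us # vs # fs) \<and> root_path c (b # ys)" if "p \<in> ?A" for p
    using that unfolding spine_configs_def length_Suc_conv by blast
  {
    fix p q assume pq: "p \<in> ?A" "q \<in> ?A"
    obtain c us vs fs where p: "p = (c, us # vs # fs)" "root_path c (b # ys)"
      using A[OF pq(1)] by blast
    obtain c' us' vs' fs' where q: "q = (c', us' # vs' # fs')" "root_path c' (b # ys)"
      using A[OF pq(2)] by blast
    have P: "b \<in> set (labels c)" "b \<in> set (labels c')"
      using root_path_subset[OF p(2)] root_path_subset[OF q(2)] by simp_all
    then have N: "\<forall>u\<in>set us. b \<notin> set (labels u)" "\<forall>u\<in>set us'. b \<notin> set (labels u)"
      using pq unfolding p q spine_configs_def by auto
    have "p = q" if "?h p = ?h q"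
      using split_at_unique[of us c vs us' c' vs' "\<lambda>u. b \<in> set (labels u)"] P N that
      unfolding p q by simp
    then show "(?h p = ?h q) = (p = q)" by blast
  next
    fix p assume p: "p \<in> ?A"
    then show "?h p \<in> ?B" using A[OF p] iff by auto
  next
    fix p assume p: "p \<in> ?B"
    then obtain ts c fs where e: "p = (Node a ts, fs)" and c: "c \<in> set ts" "root_path c (b # ys)"
      unfolding spine_configs_def root_path_Cons_iff[of _ a] by blast
    then obtain us vs where ts: "ts = us @ c # vs" by (auto dest: split_list)
    have "(c, us # vs # fs) \<in> ?A"
      using p iff[OF c(2)] unfolding e ts by blast
    then show "\<exists>q\<in>?A. p = ?h q"
      by (rule bexI[rotated]) (simp add: e ts)
  }
qed

text \<open>Each of the \<open>length xs\<close> descents along the path contributes two forests, and the children of its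
  last vertex contribute one more.\<close>

lemma spine_configs_bij:
  assumes "distinct (a # xs)" "set (a # xs) \<subseteq> S"
  shows "\<exists>h. bij_betw h (forest_tuples (r + 2 * length xs + 1) (S - set (a # xs)))
     (spine_configs (a # xs) r S)"
  using assms
proof (induction xs arbitrary: a r S)
  case Nil
  then show ?case using spine_configs_root[of a S r] by auto
next
  case (Cons b ys)
  have "\<exists>h. bij_betw h (forest_tuples (Suc (Suc r) + 2 * length ys + 1) (S - {a} - set (b # ys)))
     (spine_configs (b # ys) (Suc (Suc r)) (S - {a}))"
    using Cons.prems by (intro Cons.IH) auto
  then obtain h where h: "bij_betw h (forest_tuples (Suc (Suc r) + 2 * length ys + 1) (S - {a} - set (b # ys)))
     (spine_configs (b # ys) (Suc (Suc r)) (S - {a}))" by blast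
  have "S - {a} - set (b # ys) = S - set (a # b # ys)" 
    "Suc (Suc r) + 2 * length ys + 1 = r + 2 * length (b # ys) + 1" by auto
  then show ?case
    using bij_betw_trans[OF h spine_configs_child[of a S]] Cons.prems by auto
qed

definition trees_with_path :: "'a list \<Rightarrow> 'a set \<Rightarrow> 'a otree set" where
  "trees_with_path xs S = {t. root_path t xs \<and> distinct (labels t) \<and> set (labels t) = S}"

lemma card_trees_with_path:
  assumes "finite S" "distinct xs" "set xs \<subseteq> S" "length xs = Suc d"
  shows "finite (trees_with_path xs S)"
    and "card (trees_with_path xs S) * fact (card S + d) = (2 * d + 1) * fact (2 * card S - 2)"
proof -
  obtain a ys where xs: "xs = a # ys" "length ys = d"
    using assms(4) by (auto simp: length_Suc_conv)
  have sp: "spine_configs xs 0 S = (\<lambda>t. (t, [])) ` trees_with_path xs S"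
    by (auto simp: spine_configs_def trees_with_path_def)
  have inj: "inj_on (\<lambda>t. (t, [])) (trees_with_path xs S)" by (auto simp: inj_on_def)
  obtain h where h: "bij_betw h (forest_tuples (2 * d + 1) (S - set xs)) (spine_configs xs 0 S)"
    using spine_configs_bij[of a ys S 0] assms xs by auto
  have cS: "card (S - set xs) = card S - Suc d"
    using assms by (simp add: card_Diff_subset distinct_card)
  have le: "Suc d \<le> card S"
    using card_mono[OF assms(1,3)] assms by (simp add: distinct_card)
  note ft = finite_card_forest_tuples[of "S - set xs" "2 * d + 1"]
  have fin: "finite (spine_configs xs 0 S)"
    using h ft assms(1) by (auto simp: bij_betw_finite)
  then show "finite (trees_with_path xs S)"
    unfolding sp using finite_imageD[OF _ inj] by blast
  have "card (trees_with_path xs S) = card (forest_tuples (2 * d + 1) (S - set xs))"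
    using bij_betw_same_card[OF h] unfolding sp by (simp add: card_image[OF inj])
  moreover have "card S - Suc d + (2 * d + 1) = card S + d"
    "2 * (card S - Suc d) + (2 * d + 1) - 1 = 2 * card S - 2"
    using le by auto
  moreover have "card (forest_tuples (2 * d + 1) (S - set xs)) * fact (card S - Suc d + (2 * d + 1)) =
      (2 * d + 1) * fact (2 * (card S - Suc d) + (2 * d + 1) - 1)"
    using ft assms(1) unfolding cS by simp
  ultimately show "card (trees_with_path xs S) * fact (card S + d) = (2 * d + 1) * fact (2 * card S - 2)"
    by metis
qed

section \<open>Counting the possible root paths\<close>

lemma card_subsets_split:
  assumes "finite A" "finite B" "A \<inter> B = {}"
  shows "card {X. X \<subseteq> A \<union> B \<and> card (X \<inter> A) = k \<and> card (X \<inter> B) = e} =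
    (card A choose k) * (card B choose e)"
proof -
  let ?P = "\<lambda>A k. {X. X \<subseteq> A \<and> card X = k}"
  have "bij_betw (\<lambda>(Y, Z). Y \<union> Z) (?P A k \<times> ?P B e)
     {X. X \<subseteq> A \<union> B \<and> card (X \<inter> A) = k \<and> card (X \<inter> B) = e}"
    (is "bij_betw ?f ?D ?R")
  proof (rule bij_betw_byWitness[where f' = "\<lambda>X. (X \<inter> A, X \<inter> B)"])
    have *: "(Y \<union> Z) \<inter> A = Y" "(Y \<union> Z) \<inter> B = Z" if "Y \<subseteq> A" "Z \<subseteq> B" for Y Z
      using that assms(3) by auto
    show "\<forall>p\<in>?D. (\<lambda>X. (X \<inter> A, X \<inter> B)) (?f p) = p"
      using * by auto
    show "?f ` ?D \<subseteq> ?R" using * by auto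
    show "\<forall>X\<in>?R. ?f (X \<inter> A, X \<inter> B) = X" by auto
    show "(\<lambda>X. (X \<inter> A, X \<inter> B)) ` ?R \<subseteq> ?D" by auto
  qed
  then have "card ?R = card (?P A k \<times> ?P B e)"
    by (rule bij_betw_same_card[symmetric])
  also have "\<dots> = (card A choose k) * (card B choose e)"
    using assms by (simp add: card_cartesian_product n_subsets)
  finally show ?thesis .
qed

definition split_lists :: "'a set \<Rightarrow> 'a set \<Rightarrow> nat \<Rightarrow> nat \<Rightarrow> 'a list set" where
  "split_lists A B k e = {xs. distinct xs \<and> set xs \<subseteq> A \<union> B \<and>
     card (set xs \<inter> A) = k \<and> card (set xs \<inter> B) = e}"

lemma card_split_lists:
  assumes "finite A" "finite B" "A \<inter> B = {}"
  shows "finite (split_lists A B k e)"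
    and "card (split_lists A B k e) = (card A choose k) * (card B choose e) * fact (k + e)"
proof -
  let ?R = "{X. X \<subseteq> A \<union> B \<and> card (X \<inter> A) = k \<and> card (X \<inter> B) = e}"
  have eq: "split_lists A B k e = (\<Union>X\<in>?R. permutations_of_set X)"
    by (auto simp: split_lists_def permutations_of_set_def)
  have fX: "finite X \<and> card X = k + e" if "X \<in> ?R" for X
  proof
    show "finite X" using that assms finite_subset by blast
    have "X = (X \<inter> A) \<union> (X \<inter> B)" using that by auto
    then show "card X = k + e"
      using that assms card_Un_disjoint[of "X \<inter> A" "X \<inter> B"] by auto
  qed
  have finR: "finite ?R"
    by (rule finite_subset[of _ "Pow (A \<union> B)"]) (use assms in auto)
  show "finite (split_lists A B k e)" unfolding eq using finR by simp
  have "card (split_lists A B k e) = (\<Sum>X\<in>?R. card (permutations_of_set X))"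
    unfolding eq using finR
    by (intro card_UN_disjoint) (simp_all, auto simp: permutations_of_set_def)
  also have "\<dots> = (\<Sum>X\<in>?R. fact (k + e))"
  proof (intro sum.cong refl)
    fix X assume "X \<in> ?R"
    from fX[OF this] show "card (permutations_of_set X) = fact (k + e)"
      by (simp add: card_permutations_of_set)
  qed
  also have "\<dots> = (card A choose k) * (card B choose e) * fact (k + e)"
    using card_subsets_split[OF assms] by simp
  finally show "card (split_lists A B k e) = (card A choose k) * (card B choose e) * fact (k + e)" .
qed

text \<open>By uniqueness of the path to \<open>j\<close>, its proper initial part consists of all ancestors of \<open>j\<close>.\<close>

lemma larger_ancestors_root_path:
  assumes "root_path t (xs @ [j])" "distinct (labels t)"
  shows "larger_ancestors t j = card (set xs \<inter> {j<..})"
proof -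
  have "ys = xs @ [j]" if "root_path t ys" "last ys = j" for ys
    using root_path_unique[OF that(1) assms(1) _ assms(2)] that(2) by simp
  then have "(\<exists>ys. root_path t ys \<and> last ys = j \<and> i \<in> set ys) \<longleftrightarrow> i \<in> set (xs @ [j])" for i
    using assms(1) by (metis last_snoc)
  then have "ancestor t i j \<longleftrightarrow> i \<noteq> j \<and> i \<in> set xs" for i
    unfolding ancestor_def by auto
  then have "{i. ancestor t i j \<and> i > j} = set xs \<inter> {j<..}" by auto
  then show ?thesis by (simp add: larger_ancestors_def)
qed

text \<open>Classifies the trees by the path to \<open>j\<close>; \<open>e\<close> is the number of ancestors smaller than \<open>j\<close>.\<close>

lemma labelled_otrees_larger_ancestors:
  assumes "1 \<le> j" "j \<le> n"
  shows "{t \<in> labelled_otrees n. larger_ancestors t j = k} =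
    (\<Union>e<j. \<Union>xs\<in>split_lists {j<..n} {1..<j} k e. trees_with_path (xs @ [j]) {1..n})"
    (is "?L = ?R")
proof (intro equalityI subsetI)
  fix t assume t: "t \<in> ?L"
  then have d: "distinct (labels t)" "set (labels t) = {1..n}" by (auto simp: labelled_otrees_def)
  then obtain xs where xs: "root_path t (xs @ [j])"
    using root_path_exists[of j t] assms by auto
  have dx: "distinct (xs @ [j])" "set (xs @ [j]) \<subseteq> {1..n}"
    using root_path_distinct[OF xs d(1)] root_path_subset[OF xs] d(2) by auto
  have "set xs \<inter> {j<..} = set xs \<inter> {j<..n}" using dx by auto
  then have "card (set xs \<inter> {j<..n}) = k"
    using t larger_ancestors_root_path[OF xs d(1)] by auto
  moreover have "set xs \<subseteq> {j<..n} \<union> {1..<j}"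
  proof
    fix x assume "x \<in> set xs"
    then have "x \<noteq> j" "x \<in> {1..n}" using dx by auto
    then show "x \<in> {j<..n} \<union> {1..<j}" by auto
  qed
  ultimately have sl: "xs \<in> split_lists {j<..n} {1..<j} k (card (set xs \<inter> {1..<j}))"
    using dx by (auto simp: split_lists_def)
  have "card (set xs \<inter> {1..<j}) \<le> card {1..<j}" by (intro card_mono) auto
  then have "card (set xs \<inter> {1..<j}) < j" using assms by simp
  moreover have "t \<in> trees_with_path (xs @ [j]) {1..n}"
    using xs d by (simp add: trees_with_path_def)
  ultimately show "t \<in> ?R" using sl by blast
next
  fix t assume "t \<in> ?R"
  then obtain e xs where e: "xs \<in> split_lists {j<..n} {1..<j} k e" "t \<in> trees_with_path (xs @ [j]) {1..n}"
    by blast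
  then have d: "root_path t (xs @ [j])" "distinct (labels t)" "set (labels t) = {1..n}"
    by (auto simp: trees_with_path_def)
  have "set xs \<inter> {j<..} = set xs \<inter> {j<..n}" using e(1) by (auto simp: split_lists_def)
  then have "larger_ancestors t j = k"
    using larger_ancestors_root_path[OF d(1,2)] e(1) by (simp add: split_lists_def)
  moreover have "length (labels t) = n" using distinct_card[OF d(2)] d(3) by simp
  ultimately show "t \<in> ?L" using d by (simp add: labelled_otrees_def)
qed

lemma card_larger_ancestors:
  assumes "1 \<le> j" "j \<le> n"
  shows "real (card {t \<in> labelled_otrees n. larger_ancestors t j = k}) =
    (\<Sum>e<j. real ((n - j) choose k) * real ((j - 1) choose e) * fact (k + e) *
       ((2 * real (k + e) + 1) * fact (2 * n - 2) / fact (n + k + e)))"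
proof -
  let ?S = "\<lambda>e. split_lists {j<..n} {1..<j} k e"
  let ?T = "\<lambda>xs. trees_with_path (xs @ [j]) {1..n}"
  have disj_AB: "{j<..n} \<inter> {1..<j} = {}" by auto
  have fS: "finite (?S e)" and cS: "card (?S e) = ((n - j) choose k) * ((j - 1) choose e) * fact (k + e)" for e
    using card_split_lists[of "{j<..n}" "{1..<j}" k e] disj_AB by simp_all
  have len: "length xs = k + e" if "xs \<in> ?S e" for xs e
  proof -
    have "length xs = card (set xs)" using that by (simp add: split_lists_def distinct_card)
    also have "set xs = (set xs \<inter> {j<..n}) \<union> (set xs \<inter> {1..<j})"
      using that by (auto simp: split_lists_def)
    also have "card \<dots> = k + e"
      using that by (subst card_Un_disjoint) (auto simp: split_lists_def)
    finally show ?thesis .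
  qed
  have T: "finite (?T xs)" 
    "real (card (?T xs)) = (2 * real (k + e) + 1) * fact (2 * n - 2) / fact (n + k + e)"
    if "xs \<in> ?S e" for xs e
  proof -
    have xs: "distinct (xs @ [j])" "set (xs @ [j]) \<subseteq> {1..n}" "length (xs @ [j]) = Suc (k + e)"
      using that len[OF that] assms by (auto simp: split_lists_def)
    note c = card_trees_with_path[OF _ xs, simplified]
    show "finite (?T xs)" using c(1) by simp
    have "real (card (?T xs) * fact (n + (k + e))) = real ((2 * (k + e) + 1) * fact (2 * n - 2))"
      using c(2) by simp
    then have "real (card (?T xs)) * fact (n + k + e) = (2 * real (k + e) + 1) * fact (2 * n - 2)"
      by (simp add: add.assoc of_nat_fact algebra_simps)
    then show "real (card (?T xs)) = (2 * real (k + e) + 1) * fact (2 * n - 2) / fact (n + k + e)"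
      by (simp add: field_simps)
  qed
  have disj: "?T xs \<inter> ?T ys = {}" if "xs \<noteq> ys" for xs ys
    using that root_path_unique[of _ "xs @ [j]" "ys @ [j]"] by (auto simp: trees_with_path_def)
  have disjS: "?S e \<inter> ?S e' = {}" if "e \<noteq> e'" for e e'
    using that by (auto simp: split_lists_def)
  have inner: "real (card (\<Union>xs\<in>?S e. ?T xs)) =
      real ((n - j) choose k) * real ((j - 1) choose e) * fact (k + e) *
       ((2 * real (k + e) + 1) * fact (2 * n - 2) / fact (n + k + e))" for e
  proof -
    have "card (\<Union>xs\<in>?S e. ?T xs) = (\<Sum>xs\<in>?S e. card (?T xs))"
      using fS T(1) disj by (intro card_UN_disjoint) auto
    then have "real (card (\<Union>xs\<in>?S e. ?T xs)) = (\<Sum>xs\<in>?S e. real (card (?T xs)))" by simp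
    also have "\<dots> = (\<Sum>xs\<in>?S e. (2 * real (k + e) + 1) * fact (2 * n - 2) / fact (n + k + e))"
      using T(2) by (intro sum.cong) auto
    also have "\<dots> = real (card (?S e)) * ((2 * real (k + e) + 1) * fact (2 * n - 2) / fact (n + k + e))"
      by simp
    finally show ?thesis unfolding cS by simp
  qed
  have "card (\<Union>e<j. \<Union>xs\<in>?S e. ?T xs) = (\<Sum>e<j. card (\<Union>xs\<in>?S e. ?T xs))"
  proof (rule card_UN_disjoint)
    show "\<forall>e\<in>{..<j}. finite (\<Union>xs\<in>?S e. ?T xs)" using fS T(1) by blast
    show "\<forall>e\<in>{..<j}. \<forall>e'\<in>{..<j}. e \<noteq> e' \<longrightarrow> (\<Union>xs\<in>?S e. ?T xs) \<inter> (\<Union>xs\<in>?S e'. ?T xs) = {}"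
    proof (intro ballI impI)
      fix e e' :: nat assume "e \<noteq> e'"
      then have "xs \<noteq> ys" if "xs \<in> ?S e" "ys \<in> ?S e'" for xs ys
        using disjS that by blast
      then show "(\<Union>xs\<in>?S e. ?T xs) \<inter> (\<Union>xs\<in>?S e'. ?T xs) = {}"
        using disj by blast
    qed
  qed simp
  then show ?thesis
    unfolding labelled_otrees_larger_ancestors[OF assms] using inner by simp
qed

text \<open>Every tree has exactly one root path of length one, so the count for a fixed root is multiplied
  by the \<open>n\<close> possible roots.\<close>

lemma card_labelled_otrees:
  assumes "1 \<le> n"
  shows "real (card (labelled_otrees n)) = fact (n - 1) * real ((2 * (n - 1)) choose (n - 1))"
proof -
  let ?T = "\<lambda>a. trees_with_path [a] {1..n}"
  have "t \<in> labelled_otrees n \<longleftrightarrow> t \<in> (\<Union>a\<in>{1..n}. ?T a)" for t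
  proof -
    obtain a ts where t: "t = Node a ts" by (cases t)
    have "root_path t [b] \<longleftrightarrow> b = a" for b
      unfolding t root_path_Cons_iff by auto
    moreover have "a \<in> set (labels t)" by (simp add: t)
    moreover have "length (labels t) = n" if "distinct (labels t)" "set (labels t) = {1..n}"
      using distinct_card[OF that(1)] that(2) by simp
    ultimately show ?thesis
      unfolding labelled_otrees_def trees_with_path_def by blast
  qed
  then have eq: "labelled_otrees n = (\<Union>a\<in>{1..n}. ?T a)" by blast
  have c: "finite (?T a)" "card (?T a) * fact n = fact (2 * n - 2)" if "a \<in> {1..n}" for a
    using card_trees_with_path[of "{1..n}" "[a]" 0] that by auto
  have "card (labelled_otrees n) = (\<Sum>a\<in>{1..n}. card (?T a))"
    unfolding eq using c(1)
    by (intro card_UN_disjoint) (auto simp: trees_with_path_def root_path_Cons_iff)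
  then have "card (labelled_otrees n) * fact n = (\<Sum>a\<in>{1..n}. card (?T a) * fact n)"
    by (simp add: sum_distrib_right)
  also have "\<dots> = n * fact (2 * n - 2)" using c(2) by simp
  finally have "real (card (labelled_otrees n) * fact n) = real (n * fact (2 * n - 2))" by simp
  then have "real (card (labelled_otrees n)) * (n * fact (n - 1)) = n * fact (2 * (n - 1))"
    using assms by (simp add: of_nat_fact fact_reduce[of n] diff_mult_distrib2)
  then have "real (card (labelled_otrees n)) * fact (n - 1) = fact (2 * (n - 1))"
    using assms by simp
  then show ?thesis
    by (simp add: binomial_fact field_simps mult_2)
qed

section \<open>The distribution\<close>

text \<open>Distribute \<open>k + p\<close> large and \<open>e + q\<close> small labels over \<open>k + e\<close> ancestors and \<open>p + q\<close> other
  vertices so that \<open>k\<close> ancestors are large. The probability of this is the same whether one draws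
  the labels of the ancestors or the positions of the large labels.\<close>

lemma binomial_exchange:
  "real ((k + p) choose k) * real ((e + q) choose e) * fact (k + e) * fact (p + q) * real ((k + p + e + q) choose (e + q))
   = fact (k + p + e + q) * real ((p + q) choose p) * real ((k + e) choose k)"
  by (simp add: binomial_fact field_simps)

theorem mainTheorem3:
  fixes n j k :: nat
  assumes "1 \<le> j" and "j \<le> n" and "k \<le> n - j"
  shows "measure_pmf.prob (pmf_of_set (labelled_otrees n)) {t. larger_ancestors t j = k} =
    1 / (real ((n - 1) choose (j - 1)) * real ((2 * (n - 1)) choose (n - 1))) *
    (\<Sum>l = n - j - k..n - k - 1.
       real (l choose (n - j - k)) * real ((2 * n - 2) choose l) * real ((n - l - 1) choose k) *
       ((2 * real n - 1 - 2 * real l) / (2 * real n - 1 - real l)))"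
proof -
  let ?C = "real ((n - 1) choose (j - 1))" and ?B = "real ((2 * (n - 1)) choose (n - 1))"
  let ?w = "\<lambda>l. real (l choose (n - j - k)) * real ((2 * n - 2) choose l) * real ((n - l - 1) choose k) *
       ((2 * real n - 1 - 2 * real l) / (2 * real n - 1 - real l))"
  let ?v = "\<lambda>e. real ((n - j) choose k) * real ((j - 1) choose e) * fact (k + e) *
       ((2 * real (k + e) + 1) * fact (2 * n - 2) / fact (n + k + e))"
  have C: "?C > 0"
    using assms by simp
  have n: "1 \<le> n" using assms by simp
  have summand: "?v e = fact (n - 1) / ?C * ?w (n - 1 - (k + e))" if "e < j" for e
  proof -
    (* Among the vertices outside the path, p are larger and q are smaller than j. *)
    define p q where "p = n - j - k" and "q = j - 1 - e"
    have j: "j = e + q + 1" and N: "n = k + p + e + q + 1" using assms that by (auto simp: p_def q_def)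
    have l: "n - 1 - (k + e) = p + q" "n - (p + q) - 1 = k + e" "n - j = k + p" "j - 1 = e + q"
      "n - j - k = p"
      using j N by auto
    have n1: "n - 1 = k + p + e + q" using N by simp
    have two: "2 * n - 2 = (p + q) + (n + k + e - 1)" using N by auto
    have ch: "real ((2 * n - 2) choose (p + q)) = fact (2 * n - 2) / (fact (p + q) * fact (n + k + e - 1))"
      unfolding two by (simp add: binomial_fact)
    have fa: "fact (n + k + e) = (real (n + k + e)) * fact (n + k + e - 1)"
      using n by (simp add: fact_reduce)
    have lin: "2 * real n - 1 - 2 * real (p + q) = 2 * real (k + e) + 1"
      "2 * real n - 1 - real (p + q) = real (n + k + e)" using N by auto
    have ex: "real ((k + p) choose k) * real ((e + q) choose e) * fact (k + e) =
       fact (n - 1) / ?C * real ((p + q) choose p) * real ((k + e) choose k) / fact (p + q)"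
      using binomial_exchange[of k p e q] C unfolding l n1 by (simp add: field_simps)
    show ?thesis
      unfolding l ex ch fa lin by (simp add: mult_ac)
  qed
  have "(\<Sum>e<j. ?v e) = (\<Sum>e<j. fact (n - 1) / ?C * ?w (n - 1 - (k + e)))"
    using summand by (intro sum.cong) auto
  also have "\<dots> = fact (n - 1) / ?C * (\<Sum>e<j. ?w (n - 1 - (k + e)))"
    by (rule sum_distrib_left[symmetric])
  also have "(\<Sum>e<j. ?w (n - 1 - (k + e))) = (\<Sum>l = n - j - k..n - k - 1. ?w l)"
    by (rule sum.reindex_bij_witness[of _ "\<lambda>l. n - 1 - k - l" "\<lambda>e. n - 1 - (k + e)"])
       (use assms in auto)
  finally have sum: "(\<Sum>e<j. ?v e) = fact (n - 1) / ?C * (\<Sum>l = n - j - k..n - k - 1. ?w l)" .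
  have "measure_pmf.prob (pmf_of_set (labelled_otrees n)) {t. larger_ancestors t j = k} =
     real (card {t \<in> labelled_otrees n. larger_ancestors t j = k}) / real (card (labelled_otrees n))"
    using labelled_otrees_nonempty[OF n] finite_labelled_otrees[of n]
    by (simp add: measure_pmf_of_set Int_def)
  also have "\<dots> = (fact (n - 1) / ?C * (\<Sum>l = n - j - k..n - k - 1. ?w l)) / (fact (n - 1) * ?B)"
    unfolding card_larger_ancestors[OF assms(1,2)] card_labelled_otrees[OF n] sum ..
  also have "\<dots> = 1 / (?C * ?B) * (\<Sum>l = n - j - k..n - k - 1. ?w l)"
    by simp
  finally show ?thesis .
qed

end
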